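(* Let $\kappa\in\mathcal{L}_1$ and let $k$ be its associated Sonine kernel. Let $a_j\in\mathbb{C}$, $j\in\mathbb{N}_0$, be such that the power series $\sum_{j=0}^{+\infty}a_jz^j$ has non-zero convergence radius, and let $f$ be the function defined by the convolution series $$f(x)=\sum_{j=0}^{+\infty}a_j\,\kappa^{<j+1>}(x),\quad x>0.$$ Then this representation is the generalized convolution Taylor series of $f$, i.e., the coefficients are given by $$a_j=\left(\mathbb{I}_{(k)}\,\mathbb{D}_{(k)}^{<j>}\,f\right)(0),\quad j=0,1,2,\dots,$$ where $\mathbb{I}_{(k)}$ is the general fractional integral with the kernel $k$ and $\mathbb{D}_{(k)}^{<j>}$ is the $j$-fold sequential general fractional derivative in the Riemann-Liouville sense.
   Context: Functions are defined on $(0,+\infty)$ and may be complex-valued. Convolution: $(f*g)(x)=\int_0^x f(x-\xi)g(\xi)\,d\xi$, $x>0$. Convolution powers: $g^{<1>}=g$ and $g^{<n>}=g*\cdots*g$ ($n$ factors) for $n\ge 2$. Space: $C_{-1,0}(0,+\infty)=\{f:\ f(x)=x^{p-1}f_1(x),\ x>0,\ \text{for some } 0<p<1 \text{ and } f_1\in C[0,+\infty)\}$. Sonine kernels: a pair $\kappa,k$ belongs to $\mathcal{L}_1$ if $\kappa,k\in C_{-1,0}(0,+\infty)$ and $(\kappa*k)(x)=1$ for all $x>0$. The function $k$ is called the Sonine kernel associated to $\kappa$; $\kappa\in\mathcal{L}_1$ means that $\kappa$ belongs to such a pair. Operators: $(\mathbb{I}_{(k)}f)(x)=(k*f)(x)$;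 $(\mathbb{D}_{(k)}f)(x)=\frac{d}{dx}(k*f)(x)$; $\mathbb{D}_{(k)}^{<j>}$ is the $j$-fold composition of $\mathbb{D}_{(k)}$ with itself, with $\mathbb{D}_{(k)}^{<0>}f=f$. For a function $g$ on $(0,+\infty)$, $g(0)$ denotes the value at $0$ of its continuous extension, i.e. $\lim_{x\to 0+}g(x)$. *)

theory Defs
  imports "HOL-Analysis.Analysis"
begin

text \<open>Functions on \<open>(0,\<infinity>)\<close> are represented by total functions \<open>real \<Rightarrow> complex\<close>; only their
  values at positive arguments matter.\<close>

definition conv_integrable :: "(real \<Rightarrow> complex) \<Rightarrow> (real \<Rightarrow> complex) \<Rightarrow> bool" where
  "conv_integrable f g \<longleftrightarrow>
     (\<forall>x>0. set_integrable lborel {0<..<x} (\<lambda>\<xi>. f (x - \<xi>) * g \<xi>))"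

definition laplace_conv :: "(real \<Rightarrow> complex) \<Rightarrow> (real \<Rightarrow> complex) \<Rightarrow> real \<Rightarrow> complex"
    (infixl \<open>\<star>\<close> 70) where
  "(f \<star> g) x = (LINT \<xi>:{0<..<x}|lborel. f (x - \<xi>) * g \<xi>)"

text \<open>The convolution power with \<open>n\<close> factors, for \<open>n \<ge> 1\<close>; the value at \<open>n = 0\<close> is junk.\<close>

definition conv_power :: "(real \<Rightarrow> complex) \<Rightarrow> nat \<Rightarrow> real \<Rightarrow> complex" where
  "conv_power g n = ((\<lambda>h. g \<star> h) ^^ (n - 1)) g"

definition C_m1_0 :: "(real \<Rightarrow> complex) set" where
  "C_m1_0 = {f. \<exists>p f1. 0 < p \<and> p < 1 \<and> continuous_on {0..} f1 \<and>
                  (\<forall>x>0. f x = of_real (x powr (p - 1)) * f1 x)}"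

text \<open>\<open>sonine_pair \<kappa> k\<close>: the pair \<open>\<kappa>, k\<close> belongs to \<open>\<L>\<^sub>1\<close>, i.e. \<open>k\<close> is the Sonine kernel
  associated to \<open>\<kappa>\<close>.\<close>

definition sonine_pair :: "(real \<Rightarrow> complex) \<Rightarrow> (real \<Rightarrow> complex) \<Rightarrow> bool" where
  "sonine_pair \<kappa> k \<longleftrightarrow> \<kappa> \<in> C_m1_0 \<and> k \<in> C_m1_0 \<and> (\<forall>x>0. (\<kappa> \<star> k) x = 1)"

definition GFI :: "(real \<Rightarrow> complex) \<Rightarrow> (real \<Rightarrow> complex) \<Rightarrow> real \<Rightarrow> complex" where
  "GFI k f x = (k \<star> f) x"

text \<open>The total operator \<^const>\<open>vector_derivative\<close> is the derivative of \<open>k \<star> f\<close> only where that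
  function is differentiable, and the integral is meaningful only if \<^term>\<open>conv_integrable k f\<close>;
  \<open>GFD_exists k f\<close> says that both hold on \<open>(0,\<infinity>)\<close>.\<close>

definition GFD :: "(real \<Rightarrow> complex) \<Rightarrow> (real \<Rightarrow> complex) \<Rightarrow> real \<Rightarrow> complex" where
  "GFD k f x = vector_derivative (k \<star> f) (at x)"

definition GFD_exists :: "(real \<Rightarrow> complex) \<Rightarrow> (real \<Rightarrow> complex) \<Rightarrow> bool" where
  "GFD_exists k f \<longleftrightarrow> conv_integrable k f \<and> (\<forall>x>0. (k \<star> f) differentiable (at x))"

definition GFD_seq :: "(real \<Rightarrow> complex) \<Rightarrow> nat \<Rightarrow> (real \<Rightarrow> complex) \<Rightarrow> real \<Rightarrow> complex" where
  "GFD_seq k j f = (GFD k ^^ j) f"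

end

theory Submission
  imports Defs
begin

text \<open>Write \<open>S a = \<Sum>\<^sub>n a\<^sub>n \<kappa>\<^sup><\<^sup>n\<^sup>+\<^sup>1\<^sup>>\<close>. If \<open>\<kappa>\<close> is bounded by \<open>M x\<^sup>p\<^sup>-\<^sup>1\<close> near 0, Beta integrals bound
  the convolution powers by \<open>c\<^sub>n x\<^sup>(\<^sup>n\<^sup>+\<^sup>1\<^sup>)\<^sup>p\<^sup>-\<^sup>1\<close> with \<open>c\<^sub>n\<^sub>+\<^sub>1 / c\<^sub>n = M B((n + 1) p, p) \<rightarrow> 0\<close>, so the series
  converges for every positive radius of convergence of \<open>a\<close>, locally uniformly up to the factor
  \<open>x\<^sup>p\<^sup>-\<^sup>1\<close>, and may be convolved termwise: \<open>S a = a\<^sub>0 \<kappa> + \<kappa> \<star> S a'\<close>, where \<open>a'\<close> is the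
  shifted sequence. As \<open>k \<star> \<kappa> = 1\<close>, associativity gives \<open>k \<star> S a = a\<^sub>0 + 1 \<star> S a'\<close>. This
  tends to \<open>a\<^sub>0\<close> at 0 and has the derivative \<open>S a'\<close>, so each fractional derivative shifts the
  sequence by one.\<close>

section \<open>Power bounds at 0 and convolution over the whole line\<close>

text \<open>Only a bound by x^(p-1) is asked for, not a factor continuous at 0, and \<open>p\<close>
  may exceed 1. The scale thus contains the constant 1 and all convolution powers, and exponents add
  under convolution. The constant may depend on \<open>X\<close>, as nothing is known at
  infinity.\<close>

definition sing_space :: "real \<Rightarrow> (real \<Rightarrow> complex) set" where
  "sing_space p = {g. continuous_on {0<..} g \<and>
     (\<forall>X>0. \<exists>C. \<forall>x\<in>{0<..X}. norm (g x) \<le> C * x powr (p - 1))}"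

text \<open>Cutting functions off at 0 turns the convolution on \<open>(0,x)\<close> into one over the whole line
  and removes the junk values at nonpositive arguments.\<close>

definition causal :: "(real \<Rightarrow> 'a) \<Rightarrow> real \<Rightarrow> 'a::real_vector" where
  "causal g x = indicator {0<..} x *\<^sub>R g x"

lemma sing_spaceE:
  assumes "g \<in> sing_space p" "X > 0"
  obtains C where "C \<ge> 0" "\<And>x. 0 < x \<Longrightarrow> x \<le> X \<Longrightarrow> norm (g x) \<le> C * x powr (p - 1)"
proof -
  obtain C where C: "\<forall>x\<in>{0<..X}. norm (g x) \<le> C * x powr (p - 1)"
    using assms unfolding sing_space_def by blast
  have "0 \<le> norm (g X)" by simp
  also have "\<dots> \<le> C * X powr (p - 1)" using C assms(2) by simp
  finally have "C \<ge> 0" using assms(2) by (simp add: zero_le_mult_iff)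
  with C that show ?thesis by auto
qed

lemma sing_space_continuous: "g \<in> sing_space p \<Longrightarrow> continuous_on {0<..} g"
  by (simp add: sing_space_def)

lemma causal_nonpos [simp]: "x \<le> 0 \<Longrightarrow> causal g x = 0"
  and causal_pos [simp]: "x > 0 \<Longrightarrow> causal g x = g x"
  by (auto simp: causal_def)

lemma causal_measurable:
  "g \<in> sing_space p \<Longrightarrow> causal g \<in> borel_measurable borel"
  unfolding causal_def[abs_def]
  by (intro borel_measurable_continuous_on_indicator sing_space_continuous) auto

lemma conv_integrand_causal:
  fixes g h :: "real \<Rightarrow> complex"
  shows "indicator {0<..<x} \<xi> *\<^sub>R (g (x - \<xi>) * h \<xi>) = causal g (x - \<xi>) * causal h \<xi>"
  by (auto simp: causal_def indicator_def)

lemma laplace_conv_causal: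
  "(g \<star> h) x = (\<integral>\<xi>. causal g (x - \<xi>) * causal h \<xi> \<partial>lborel)"
  by (simp add: laplace_conv_def set_lebesgue_integral_def conv_integrand_causal)

lemma conv_integrable_causal:
  "conv_integrable g h \<longleftrightarrow> (\<forall>x>0. integrable lborel (\<lambda>\<xi>. causal g (x - \<xi>) * causal h \<xi>))"
  by (simp add: conv_integrable_def set_integrable_def conv_integrand_causal)

lemma causal_cong:
  assumes "\<And>x. x > 0 \<Longrightarrow> g x = g' x"
  shows "causal g = causal g'"
proof
  show "causal g x = causal g' x" for x
    using assms[of x] by (cases "x > 0") auto
qed

text \<open>The integrand sees only positive arguments, so the equality holds between total
  functions and can be used under \<open>vector_derivative\<close>.\<close>

lemma laplace_conv_cong:
  assumes "\<And>x. x > 0 \<Longrightarrow> g x = g' x" "\<And>x. x > 0 \<Longrightarrow> h x = h' x"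
  shows "g \<star> h = g' \<star> h'"
  unfolding laplace_conv_causal[abs_def] using assms by (simp add: causal_cong[of g g'] causal_cong[of h h'])

lemma conv_integrable_cong:
  assumes "\<And>x. x > 0 \<Longrightarrow> g x = g' x" "\<And>x. x > 0 \<Longrightarrow> h x = h' x"
  shows "conv_integrable g h \<longleftrightarrow> conv_integrable g' h'"
  unfolding conv_integrable_causal using assms by (simp add: causal_cong[of g g'] causal_cong[of h h'])

lemma laplace_conv_commute: "g \<star> h = h \<star> g"
proof
  fix x
  show "(g \<star> h) x = (h \<star> g) x"
    unfolding laplace_conv_causal
    by (subst lborel_integral_real_affine[where c = "-1" and t = x]) (simp_all add: mult.commute)
qed

lemma laplace_conv_nonpos: "x \<le> 0 \<Longrightarrow> (g \<star> h) x = 0"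
  by (simp add: laplace_conv_def set_lebesgue_integral_def)

text \<open>Removes the inner cutoff in iterated convolutions, which then become double integrals
  over the plane.\<close>

lemma causal_laplace_conv: "causal (g \<star> h) = g \<star> h"
  by (rule ext) (auto simp: causal_def indicator_def laplace_conv_nonpos)

section \<open>Rescaling and Beta integrals\<close>

text \<open>Moves the dependence on \<open>x\<close> from the domain into the integrand, where
  dominated convergence can handle it.\<close>

lemma integral_indicator_rescale:
  fixes F :: "real \<Rightarrow> 'a::{banach, second_countable_topology}"
  assumes "x > 0"
  shows "(\<integral>\<xi>. indicator {0<..<x} \<xi> *\<^sub>R F \<xi> \<partial>lborel) =
         x *\<^sub>R (\<integral>t. indicator {0<..<1} t *\<^sub>R F (x * t) \<partial>lborel)"
proof -
  have "indicat_real {0<..<x} (x * t) = indicator {0<..<1} t" for t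
    using assms by (auto simp: indicator_def zero_less_mult_iff)
  then show ?thesis
    using assms by (subst lborel_integral_real_affine[where c = x and t = 0]) simp_all
qed

text \<open>Euler's integral, arranged like the integrand of a convolution at x = 1; hence the order
  \<open>Beta q p\<close>.\<close>

lemma has_bochner_integral_Beta:
  assumes "p > 0" "q > (0::real)"
  shows "has_bochner_integral lborel
           (\<lambda>t. indicator {0<..<1} t *\<^sub>R ((1 - t) powr (p - 1) * t powr (q - 1))) (Beta q p)"
proof -
  have int: "set_integrable lborel {0<..<1::real} (\<lambda>t. t powr (q - 1) * (1 - t) powr (p - 1))"
    by (rule set_integrable_subset[OF integrable_Beta]) (use assms in auto)
  have "((\<lambda>t. t powr (q - 1) * (1 - t) powr (p - 1)) has_integral Beta q p) {0<..<1}"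
    using has_integral_Beta_real[of q p] assms by (simp add: has_integral_Icc_iff_Ioo)
  then have "(LINT t:{0<..<1}|lborel. t powr (q - 1) * (1 - t) powr (p - 1)) = Beta q p"
    using set_borel_integral_eq_integral(2)[OF int] by (simp add: integral_unique)
  with int show ?thesis
    unfolding has_bochner_integral_iff set_integrable_def set_lebesgue_integral_def
    by (simp add: mult.commute)
qed

lemma Beta_nonneg:
  assumes "p > 0" "q > (0::real)"
  shows "Beta q p \<ge> 0"
  using assms unfolding Beta_def by (simp add: Gamma_real_pos less_imp_le)

lemma has_bochner_integral_powr_conv:
  assumes "p > 0" "q > 0" "x > (0::real)"
  shows "has_bochner_integral lborel
           (\<lambda>\<xi>. indicator {0<..<x} \<xi> *\<^sub>R ((x - \<xi>) powr (p - 1) * \<xi> powr (q - 1)))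
           (x powr (p + q - 1) * Beta q p)"
proof -
  let ?F = "\<lambda>\<xi>. indicator {0<..<x} \<xi> *\<^sub>R ((x - \<xi>) powr (p - 1) * \<xi> powr (q - 1))"
  \<comment> \<open>The two factors contribute the exponent p + q - 2; the Jacobian \<open>x\<close>
    of the substitution raises it to p + q - 1.\<close>
  have eq: "?F (0 + x * t) = x powr (p + q - 2) *
          (indicator {0<..<1} t *\<^sub>R ((1 - t) powr (p - 1) * t powr (q - 1)))" for t
  proof (cases "t \<in> {0<..<1}")
    case True
    have "x - x * t = x * (1 - t)" by (simp add: algebra_simps)
    moreover have "p + q - 2 = (p - 1) + (q - 1)" by simp
    ultimately show ?thesis
      using True assms by (simp only: powr_add) (simp add: powr_mult indicator_def)
  next
    case False
    with assms show ?thesis by (auto simp: indicator_def zero_less_mult_iff)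
  qed
  have "has_bochner_integral lborel (\<lambda>t. ?F (0 + x * t)) (x powr (p + q - 2) * Beta q p)"
    unfolding eq using assms
    by (intro has_bochner_integral_mult_right has_bochner_integral_Beta)
  then have "has_bochner_integral lborel (\<lambda>t. ?F (0 + x * t)) ((x powr (p + q - 1) * Beta q p) /\<^sub>R \<bar>x\<bar>)"
    using assms by (simp add: powr_diff field_simps power2_eq_square)
  then show ?thesis
    using assms by (subst lborel_has_bochner_integral_real_affine_iff[where c = x and t = 0]) auto
qed

section \<open>Integrability, bounds and continuity of convolutions\<close>

lemma borel_measurable_conv_integrand:
  assumes "g \<in> sing_space p" "h \<in> sing_space q"
  shows "(\<lambda>\<xi>. causal g (x - \<xi>) * causal h \<xi>) \<in> borel_measurable borel"
  using causal_measurable[OF assms(1)] causal_measurable[OF assms(2)] by measurable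

text \<open>All three claims come from the majorant C D (x - \<xi>)^(p-1) \<xi>^(q-1). The constant
  is kept explicit: its decay under iteration makes convolution series converge, and the bound on
  the integral of the norm justifies termwise integration.\<close>

lemma
  assumes g: "g \<in> sing_space p" and h: "h \<in> sing_space q" and pq: "p > 0" "q > 0" and x: "x > 0"
    and C: "\<And>y. 0 < y \<Longrightarrow> y \<le> x \<Longrightarrow> norm (g y) \<le> C * y powr (p - 1)"
    and D: "\<And>y. 0 < y \<Longrightarrow> y \<le> x \<Longrightarrow> norm (h y) \<le> D * y powr (q - 1)"
  shows integrable_conv_integrand_if_bounded: "integrable lborel (\<lambda>\<xi>. causal g (x - \<xi>) * causal h \<xi>)"
    and integral_norm_conv_integrand_le:
      "(\<integral>\<xi>. norm (causal g (x - \<xi>) * causal h \<xi>) \<partial>lborel) \<le> C * D * Beta q p * x powr (p + q - 1)"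
    and norm_laplace_conv_le: "norm ((g \<star> h) x) \<le> C * D * Beta q p * x powr (p + q - 1)"
proof -
  let ?G = "\<lambda>\<xi>. C * D * (indicator {0<..<x} \<xi> *\<^sub>R ((x - \<xi>) powr (p - 1) * \<xi> powr (q - 1)))"
  \<comment> \<open>The bound at \<open>x\<close> itself forces \<open>C\<close> to be nonnegative,
    as \<open>mult_mono\<close> requires.\<close>
  have "0 \<le> norm (g x)" by simp
  also have "\<dots> \<le> C * x powr (p - 1)" using C x by simp
  finally have C0: "C \<ge> 0" using x by (simp add: zero_le_mult_iff)
  have G: "has_bochner_integral lborel ?G (C * D * (x powr (p + q - 1) * Beta q p))"
    using has_bochner_integral_powr_conv[OF pq x] by (rule has_bochner_integral_mult_right)
  have le: "norm (causal g (x - \<xi>) * causal h \<xi>) \<le> ?G \<xi>" for \<xi>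
  proof (cases "\<xi> \<in> {0<..<x}")
    case True
    then have "norm (g (x - \<xi>)) * norm (h \<xi>) \<le>
        (C * (x - \<xi>) powr (p - 1)) * (D * \<xi> powr (q - 1))"
      by (intro mult_mono C D) (use C0 in auto)
    with True show ?thesis by (simp add: norm_mult mult_ac)
  qed (auto simp: causal_def indicator_def)
  show int: "integrable lborel (\<lambda>\<xi>. causal g (x - \<xi>) * causal h \<xi>)"
    by (rule Bochner_Integration.integrable_bound[OF integrable.intros[OF G]])
       (use borel_measurable_conv_integrand[OF g h] le in \<open>auto intro: order_trans[OF _ abs_ge_self]\<close>)
  have "(\<integral>\<xi>. norm (causal g (x - \<xi>) * causal h \<xi>) \<partial>lborel) \<le> (\<integral>\<xi>. ?G \<xi> \<partial>lborel)"
    using int G le by (intro integral_mono integrable_norm) (auto simp: has_bochner_integral_iff)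
  also have "\<dots> = C * D * Beta q p * x powr (p + q - 1)"
    using has_bochner_integral_integral_eq[OF G] by (simp add: mult_ac)
  finally show le': "(\<integral>\<xi>. norm (causal g (x - \<xi>) * causal h \<xi>) \<partial>lborel) \<le> C * D * Beta q p * x powr (p + q - 1)" .
  show "norm ((g \<star> h) x) \<le> C * D * Beta q p * x powr (p + q - 1)"
    unfolding laplace_conv_causal by (rule order_trans[OF integral_norm_bound le'])
qed

lemma integrable_conv_integrand:
  assumes "g \<in> sing_space p" "h \<in> sing_space q" "p > 0" "q > 0"
  shows "integrable lborel (\<lambda>\<xi>. causal g (x - \<xi>) * causal h \<xi>)"
proof (cases "x > 0")
  case True
  obtain C where C: "\<And>y. 0 < y \<Longrightarrow> y \<le> x \<Longrightarrow> norm (g y) \<le> C * y powr (p - 1)"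
    using sing_spaceE[OF assms(1) True] by blast
  obtain D where D: "\<And>y. 0 < y \<Longrightarrow> y \<le> x \<Longrightarrow> norm (h y) \<le> D * y powr (q - 1)"
    using sing_spaceE[OF assms(2) True] by blast
  show ?thesis by (rule integrable_conv_integrand_if_bounded[OF assms True C D])
next
  case False
  then have "(\<lambda>\<xi>. causal g (x - \<xi>) * causal h \<xi>) = (\<lambda>_. 0)" by (auto simp: causal_def indicator_def)
  then show ?thesis by simp
qed

lemma conv_integrable_sing_space:
  assumes "g \<in> sing_space p" "h \<in> sing_space q" "p > 0" "q > 0"
  shows "conv_integrable g h"
  unfolding conv_integrable_causal using integrable_conv_integrand[OF assms] by blast

lemma laplace_conv_rescale:
  assumes "x > 0"
  shows "(g \<star> h) x = x *\<^sub>R (\<integral>t. indicator {0<..<1} t *\<^sub>R (g (x * (1 - t)) * h (x * t)) \<partial>lborel)"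
  unfolding laplace_conv_def set_lebesgue_integral_def
  by (subst integral_indicator_rescale[OF assms]) (simp add: algebra_simps)

text \<open>Dominated convergence along sequences, applied to the integral rescaled to the fixed
  interval (0,1).\<close>

lemma continuous_on_laplace_conv:
  assumes g: "g \<in> sing_space p" and h: "h \<in> sing_space q" and pq: "p > 0" "q > 0"
  shows "continuous_on {0<..} (g \<star> h)"
proof -
  let ?J = "\<lambda>x t. indicator {0<..<1} t *\<^sub>R (g (x * (1 - t)) * h (x * t))"
  have "continuous_on {0<..} (\<lambda>x. x *\<^sub>R (\<integral>t. ?J x t \<partial>lborel))"
  proof (intro continuous_on_scaleR continuous_on_id)
    show "continuous_on {0<..} (\<lambda>x. \<integral>t. ?J x t \<partial>lborel)"
      unfolding continuous_on_sequentially comp_def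
    proof (intro allI ballI impI, elim conjE)
      fix u :: "nat \<Rightarrow> real" and a :: real
      assume a: "a \<in> {0<..}" and u: "\<forall>n. u n \<in> {0<..}" and lim: "u \<longlonglongrightarrow> a"
      obtain X where X: "\<And>n. norm (u n) \<le> X"
        using convergent_imp_Bseq[OF convergentI[OF lim]] by (auto simp: Bseq_def)
      then have X0: "X > 0" using u by (metis greaterThan_iff norm_ge_zero order.strict_trans2 real_norm_def abs_of_pos)
      obtain C where C: "C \<ge> 0" "\<And>y. 0 < y \<Longrightarrow> y \<le> X \<Longrightarrow> norm (g y) \<le> C * y powr (p - 1)"
        using sing_spaceE[OF g X0] by blast
      obtain D where D: "D \<ge> 0" "\<And>y. 0 < y \<Longrightarrow> y \<le> X \<Longrightarrow> norm (h y) \<le> D * y powr (q - 1)"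
        using sing_spaceE[OF h X0] by blast
      \<comment> \<open>The exponent may be negative, but the sequence tends to \<open>a\<close> >
        0, so the powers stay bounded; \<open>K\<close> enters the majorant.\<close>
      have "(\<lambda>n. u n powr (p + q - 2)) \<longlonglongrightarrow> a powr (p + q - 2)"
        using a lim by (intro tendsto_intros) auto
      then obtain K where K: "\<And>n. norm (u n powr (p + q - 2)) \<le> K"
        using convergent_imp_Bseq[OF convergentI, of "\<lambda>n. u n powr (p + q - 2)"] by (auto simp: Bseq_def)
      let ?w = "\<lambda>t. (C * D * K) * (indicator {0<..<1} t *\<^sub>R ((1 - t) powr (p - 1) * t powr (q - 1)))"
      \<comment> \<open>\<open>g\<close> and \<open>h\<close> are arbitrary at nonpositive
        arguments, so measurability is taken from their cutoffs, which give the same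
        integrand.\<close>
      have meas: "?J x \<in> borel_measurable borel" if "x > 0" for x
      proof -
        have "?J x = (\<lambda>t. indicator {0<..<1} t *\<^sub>R (causal g (x * (1 - t)) * causal h (x * t)))"
          using that by (auto simp: fun_eq_iff indicator_def)
        moreover have "\<dots> \<in> borel_measurable borel"
          using causal_measurable[OF g] causal_measurable[OF h] by measurable
        ultimately show ?thesis by simp
      qed
      show "(\<lambda>n. \<integral>t. ?J (u n) t \<partial>lborel) \<longlonglongrightarrow> (\<integral>t. ?J a t \<partial>lborel)"
      proof (rule integral_dominated_convergence[where w = ?w])
        show "?J a \<in> borel_measurable lborel" "\<And>n. ?J (u n) \<in> borel_measurable lborel"
          using a u by (auto intro!: meas)
        show "integrable lborel ?w"
          using has_bochner_integral_Beta[OF pq] by (auto simp: has_bochner_integral_iff)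
        show "AE t in lborel. (\<lambda>n. ?J (u n) t) \<longlonglongrightarrow> ?J a t"
        proof (rule AE_I2)
          fix t :: real
          show "(\<lambda>n. ?J (u n) t) \<longlonglongrightarrow> ?J a t"
          proof (cases "t \<in> {0<..<1}")
            case True
            have "(\<lambda>n. g (u n * (1 - t))) \<longlonglongrightarrow> g (a * (1 - t))"
              by (rule continuous_on_tendsto_compose[OF sing_space_continuous[OF g]])
                 (use True a u lim in \<open>auto intro!: tendsto_intros\<close>)
            moreover have "(\<lambda>n. h (u n * t)) \<longlonglongrightarrow> h (a * t)"
              by (rule continuous_on_tendsto_compose[OF sing_space_continuous[OF h]])
                 (use True a u lim in \<open>auto intro!: tendsto_intros\<close>)
            ultimately show ?thesis by (intro tendsto_intros)
          qed simp
        qed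
        show "AE t in lborel. norm (?J (u n) t) \<le> ?w t" for n
        proof (rule AE_I2)
          fix t :: real
          show "norm (?J (u n) t) \<le> ?w t"
          proof (cases "t \<in> {0<..<1}")
            case True
            have un: "u n > 0" "u n \<le> X" using u X[of n] by auto
            have "u n * (1 - t) \<le> u n * 1" "u n * t \<le> u n * 1"
              using True un by (intro mult_left_mono; simp)+
            then have "u n * (1 - t) \<le> X" "u n * t \<le> X"
              using un by linarith+
            then have "norm (g (u n * (1 - t))) * norm (h (u n * t)) \<le>
              (C * (u n * (1 - t)) powr (p - 1)) * (D * (u n * t) powr (q - 1))"
              using True un C(1) D(1) by (intro mult_mono C(2) D(2)) auto
            also have "\<dots> = C * D * u n powr (p + q - 2) * ((1 - t) powr (p - 1) * t powr (q - 1))"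
              using True un powr_add[of "u n" "p - 1" "q - 1"]
              by (simp add: powr_mult)
            also have "\<dots> \<le> C * D * K * ((1 - t) powr (p - 1) * t powr (q - 1))"
              using K[of n] C(1) D(1) by (intro mult_right_mono mult_left_mono) auto
            finally show ?thesis using True by (simp add: norm_mult)
          qed simp
        qed
      qed
    qed
  qed
  then show ?thesis
    by (rule continuous_on_cong[THEN iffD1, rotated -1]) (auto simp: laplace_conv_rescale)
qed

lemma sing_space_laplace_conv:
  assumes g: "g \<in> sing_space p" and h: "h \<in> sing_space q" and pq: "p > 0" "q > 0"
  shows "g \<star> h \<in> sing_space (p + q)"
  unfolding sing_space_def
proof (safe intro!: continuous_on_laplace_conv[OF assms])
  fix X :: real assume X: "X > 0"
  obtain C where C: "\<And>y. 0 < y \<Longrightarrow> y \<le> X \<Longrightarrow> norm (g y) \<le> C * y powr (p - 1)"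
    using sing_spaceE[OF g X] by blast
  obtain D where D: "\<And>y. 0 < y \<Longrightarrow> y \<le> X \<Longrightarrow> norm (h y) \<le> D * y powr (q - 1)"
    using sing_spaceE[OF h X] by blast
  show "\<exists>C. \<forall>x\<in>{0<..X}. norm ((g \<star> h) x) \<le> C * x powr (p + q - 1)"
    by (intro exI[of _ "C * D * Beta q p"] ballI norm_laplace_conv_le[OF assms] C D) auto
qed

text \<open>Norms are embedded back into the complex numbers so that the results on convolutions
  apply to them, as Fubini's theorem will require.\<close>

lemma sing_space_norm: "g \<in> sing_space p \<Longrightarrow> (\<lambda>x. complex_of_real (norm (g x))) \<in> sing_space p"
  by (auto simp: sing_space_def intro!: continuous_intros)

subsection \<open>Algebraic properties of the convolution\<close>

text \<open>Fubini's theorem for the triple product \<open>?\<Phi>\<close>. Its absolute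
  integrability is the integrability of a convolution integrand built from the norms of
  \<open>g\<close>, \<open>h\<close> and \<open>f\<close>.\<close>

lemma laplace_conv_assoc:
  assumes g: "g \<in> sing_space p" and h: "h \<in> sing_space q" and f: "f \<in> sing_space r"
    and pos: "p > 0" "q > 0" "r > 0"
  shows "g \<star> (h \<star> f) = (g \<star> h) \<star> f"
proof
  fix x :: real
  let ?\<Phi> = "\<lambda>\<xi> \<eta>. causal g (x - \<xi>) * (causal h (\<xi> - \<eta>) * causal f \<eta>)"
  let ?N = "\<lambda>g x. complex_of_real (norm (g x))"
  note [measurable] = causal_measurable[OF g] causal_measurable[OF h] causal_measurable[OF f]
  have "integrable (lborel \<Otimes>\<^sub>M lborel) (case_prod ?\<Phi>)"
  proof (rule lborel_pair.Fubini_integrable)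
    show "case_prod ?\<Phi> \<in> borel_measurable (lborel \<Otimes>\<^sub>M lborel)"
      by measurable
    have "complex_of_real (\<integral>\<eta>. norm (?\<Phi> \<xi> \<eta>) \<partial>lborel) =
        causal (?N g) (x - \<xi>) * causal (?N h \<star> ?N f) \<xi>" for \<xi>
    proof -
      have "complex_of_real (\<integral>\<eta>. norm (?\<Phi> \<xi> \<eta>) \<partial>lborel) =
          (\<integral>\<eta>. complex_of_real (norm (?\<Phi> \<xi> \<eta>)) \<partial>lborel)" by simp
      also have "\<dots> = (\<integral>\<eta>. causal (?N g) (x - \<xi>) * (causal (?N h) (\<xi> - \<eta>) * causal (?N f) \<eta>) \<partial>lborel)"
        by (intro Bochner_Integration.integral_cong) (auto simp: norm_mult causal_def indicator_def)
      also have "\<dots> = causal (?N g) (x - \<xi>) * causal (?N h \<star> ?N f) \<xi>"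
        unfolding causal_laplace_conv laplace_conv_causal by simp
      finally show ?thesis .
    qed
    moreover have "integrable lborel (\<lambda>\<xi>. causal (?N g) (x - \<xi>) * causal (?N h \<star> ?N f) \<xi>)"
      using pos by (intro integrable_conv_integrand[OF sing_space_norm[OF g]
          sing_space_laplace_conv[OF sing_space_norm[OF h] sing_space_norm[OF f]]]) auto
    ultimately have "integrable lborel (\<lambda>\<xi>. complex_of_real (\<integral>\<eta>. norm (?\<Phi> \<xi> \<eta>) \<partial>lborel))"
      by (simp only:)
    then show "integrable lborel (\<lambda>\<xi>. \<integral>\<eta>. norm (case_prod ?\<Phi> (\<xi>, \<eta>)) \<partial>lborel)"
      by (simp only: complex_of_real_integrable_eq prod.case)
    show "AE \<xi> in lborel. integrable lborel (\<lambda>\<eta>. case_prod ?\<Phi> (\<xi>, \<eta>))"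
      using integrable_conv_integrand[OF h f pos(2,3)] by simp
  qed
  then have swap: "(\<integral>\<eta>. (\<integral>\<xi>. ?\<Phi> \<xi> \<eta> \<partial>lborel) \<partial>lborel) = (\<integral>\<xi>. (\<integral>\<eta>. ?\<Phi> \<xi> \<eta> \<partial>lborel) \<partial>lborel)"
    by (rule lborel_pair.Fubini_integral)
  \<comment> \<open>Translating \<xi> by \<eta> turns the inner integral into a convolution at x -
    \<eta>.\<close>
  have inner: "(\<integral>\<xi>. ?\<Phi> \<xi> \<eta> \<partial>lborel) = (g \<star> h) (x - \<eta>) * causal f \<eta>" for \<eta>
  proof -
    have "(\<integral>\<xi>. ?\<Phi> \<xi> \<eta> \<partial>lborel) = (\<integral>\<xi>. ?\<Phi> (\<eta> + 1 * \<xi>) \<eta> \<partial>lborel)"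
      by (subst lborel_integral_real_affine[where c = 1 and t = \<eta>]) simp_all
    also have "\<dots> = (\<integral>\<xi>. causal g (x - \<eta> - \<xi>) * causal h \<xi> * causal f \<eta> \<partial>lborel)"
      by (simp add: algebra_simps)
    also have "\<dots> = (g \<star> h) (x - \<eta>) * causal f \<eta>"
      unfolding laplace_conv_causal by simp
    finally show ?thesis .
  qed
  have "(g \<star> (h \<star> f)) x = (\<integral>\<xi>. causal g (x - \<xi>) * (h \<star> f) \<xi> \<partial>lborel)"
    by (subst laplace_conv_causal) (simp only: causal_laplace_conv)
  also have "\<dots> = (\<integral>\<xi>. (\<integral>\<eta>. ?\<Phi> \<xi> \<eta> \<partial>lborel) \<partial>lborel)"
    by (simp add: laplace_conv_causal[of h f])
  also have "\<dots> = (\<integral>\<eta>. (g \<star> h) (x - \<eta>) * causal f \<eta> \<partial>lborel)"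
    unfolding swap[symmetric] inner ..
  also have "\<dots> = ((g \<star> h) \<star> f) x"
    by (subst (2) laplace_conv_causal) (simp only: causal_laplace_conv)
  finally show "(g \<star> (h \<star> f)) x = ((g \<star> h) \<star> f) x" .
qed

lemma laplace_conv_cmult_right: "(g \<star> (\<lambda>x. c * h x)) x = c * (g \<star> h) x"
proof -
  have "indicator {0<..<x} \<xi> *\<^sub>R (g (x - \<xi>) * (c * h \<xi>)) =
        c * (indicator {0<..<x} \<xi> *\<^sub>R (g (x - \<xi>) * h \<xi>))" for \<xi>
    by (simp add: algebra_simps)
  then show ?thesis
    unfolding laplace_conv_def set_lebesgue_integral_def by (simp only: integral_mult_right_zero)
qed

lemma laplace_conv_add_right:
  assumes "conv_integrable g h1" "conv_integrable g h2" "x > 0"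
  shows "(g \<star> (\<lambda>x. h1 x + h2 x)) x = (g \<star> h1) x + (g \<star> h2) x"
  using assms unfolding conv_integrable_def laplace_conv_def
  by (simp add: distrib_left set_integral_add)

section \<open>Convolution with the constant 1\<close>

lemma sing_space_1: "(\<lambda>_. 1) \<in> sing_space 1"
  by (auto simp: sing_space_def intro!: exI[of _ 1])

text \<open>Convolution with 1 is integration from 0, so this is the fundamental theorem of calculus
  at a point of continuity of an integrand that may be unbounded at 0.\<close>

lemma has_vector_derivative_one_conv:
  assumes h: "h \<in> sing_space p" and p: "p > 0" and x: "x > 0"
  shows "(((\<lambda>_. 1) \<star> h) has_vector_derivative h x) (at x)"
proof -
  have int: "set_integrable lborel {0<..<y} h" if "y > 0" for y
    using conv_integrable_sing_space[OF sing_space_1 h _ p] that by (simp add: conv_integrable_def)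
  have eq: "integral {0..y} h = ((\<lambda>_. 1) \<star> h) y" if "y > 0" for y
    using set_borel_integral_eq_integral(2)[OF int[OF that]]
    by (simp add: laplace_conv_def integral_open_interval_real)
  \<comment> \<open>The endpoint \<open>2 * x\<close> makes \<open>x\<close> an interior point. The
    empty set removed below is the finite exceptional set that the differentiation rule
    allows.\<close>
  have "h integrable_on {0..2 * x}"
    using set_borel_integral_eq_integral(1)[OF int[of "2 * x"]] x
    by (simp add: integrable_on_open_interval_real)
  moreover have "continuous (at x within {0..2 * x} - {}) h"
    using sing_space_continuous[OF h] x
    by (auto simp: continuous_on_eq_continuous_at continuous_at_imp_continuous_at_within)
  ultimately have "((\<lambda>u. integral {0..u} h) has_vector_derivative h x) (at x within ({0..2 * x} - {}))"
    using x by (intro integral_has_vector_derivative_continuous_at) auto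
  moreover have "at x within ({0..2 * x} - {}) = at x"
    using x by (intro at_within_interior) auto
  ultimately have "((\<lambda>u. integral {0..u} h) has_vector_derivative h x) (at x)"
    by (simp only:)
  then show ?thesis
    by (rule has_vector_derivative_transform_within_open[of _ _ _ "{0<..}"]) (use x eq in auto)
qed

text \<open>The convolution bound with exponents 1 and \<open>p\<close> is of order x^p.\<close>

lemma tendsto_0_one_conv:
  assumes h: "h \<in> sing_space p" and p: "p > 0"
  shows "(((\<lambda>_. 1) \<star> h) \<longlongrightarrow> 0) (at_right 0)"
proof -
  obtain D where D: "\<And>y. 0 < y \<Longrightarrow> y \<le> 1 \<Longrightarrow> norm (h y) \<le> D * y powr (p - 1)"
    using sing_spaceE[OF h, of 1] by auto
  have le: "norm (((\<lambda>_. 1) \<star> h) x) \<le> D * Beta p 1 * x powr p" if "0 < x" "x < 1" for x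
    using norm_laplace_conv_le[OF sing_space_1 h _ p that(1), of 1 D] D that by simp
  show ?thesis
  proof (rule Lim_null_comparison)
    show "\<forall>\<^sub>F x in at_right 0. norm (((\<lambda>_. 1) \<star> h) x) \<le> D * Beta p 1 * x powr p"
      using le by (auto simp: eventually_at_right_field intro!: exI[of _ 1])
    have "((\<lambda>x. x powr p) \<longlongrightarrow> 0 powr p) (at_right (0::real))"
      using p by (intro tendsto_powr') (auto simp: eventually_at_right_field intro!: tendsto_intros exI[of _ 1])
    then show "((\<lambda>x. D * Beta p 1 * x powr p) \<longlongrightarrow> 0) (at_right 0)"
      using tendsto_mult[OF tendsto_const[of "D * Beta p 1"], of "\<lambda>x. x powr p" "0 powr p"] p by simp
  qed
qed

subsection \<open>Termwise convolution of series\<close>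

context
  fixes h :: "nat \<Rightarrow> real \<Rightarrow> complex" and p :: real
  assumes h: "\<And>n. h n \<in> sing_space p"
    and bound: "\<And>X. X > 0 \<Longrightarrow> \<exists>A. summable A \<and> (\<forall>n. \<forall>x\<in>{0<..X}. norm (h n x) \<le> A n * x powr (p - 1))"
begin

lemma sing_series_abs_summable:
  assumes "x > 0"
  shows "summable (\<lambda>n. norm (h n x))"
proof -
  obtain A where A: "summable A" "\<forall>n. \<forall>y\<in>{0<..x}. norm (h n y) \<le> A n * y powr (p - 1)"
    using bound[OF assms] by blast
  show ?thesis
  proof (rule summable_comparison_test'[where N = 0])
    show "summable (\<lambda>n. A n * x powr (p - 1))"
      using A(1) by (rule summable_mult2)
    show "norm (norm (h n x)) \<le> A n * x powr (p - 1)" for n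
      using A(2) assms by simp
  qed
qed

text \<open>Multiplied by x^(1-p), the terms have the summable majorant \<open>A\<close> on all of
  (0,X], so the Weierstrass test applies to the rescaled series; dividing the factor out again
  preserves continuity at positive points.\<close>

lemma sing_series_in_sing_space: "(\<lambda>x. \<Sum>n. h n x) \<in> sing_space p"
  unfolding sing_space_def
proof (safe)
  fix X :: real assume X: "X > 0"
  obtain A where A1: "summable A" and A2: "\<forall>n. \<forall>y\<in>{0<..X}. norm (h n y) \<le> A n * y powr (p - 1)"
    using bound[of "X"] X by auto
  have A: "summable A" "\<And>n y. 0 < y \<Longrightarrow> y \<le> X \<Longrightarrow> norm (h n y) \<le> A n * y powr (p - 1)"
    using A1 A2 by auto
  show "\<exists>C. \<forall>x\<in>{0<..X}. norm (\<Sum>n. h n x) \<le> C * x powr (p - 1)"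
  proof (intro exI ballI)
    fix x assume x: "x \<in> {0<..X}"
    have "norm (\<Sum>n. h n x) \<le> (\<Sum>n. norm (h n x))"
      using x by (intro summable_norm sing_series_abs_summable) auto
    also have "\<dots> \<le> (\<Sum>n. A n * x powr (p - 1))"
      using x A by (intro suminf_le sing_series_abs_summable summable_mult2) auto
    also have "\<dots> = (\<Sum>n. A n) * x powr (p - 1)"
      using A(1) by (rule suminf_mult2[symmetric])
    finally show "norm (\<Sum>n. h n x) \<le> (\<Sum>n. A n) * x powr (p - 1)" .
  qed
next
  have "isCont (\<lambda>x. \<Sum>n. h n x) x" if x: "x > 0" for x
  proof -
    obtain A where A1: "summable A" and A2: "\<forall>n. \<forall>y\<in>{0<..2 * x}. norm (h n y) \<le> A n * y powr (p - 1)"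
      using bound[of "2 * x"] x by auto
    have A: "summable A" "\<And>n y. 0 < y \<Longrightarrow> y \<le> 2 * x \<Longrightarrow> norm (h n y) \<le> A n * y powr (p - 1)"
      using A1 A2 by auto
    have "uniform_limit {0<..<2 * x} (\<lambda>n y. \<Sum>i<n. complex_of_real (y powr (1 - p)) * h i y)
            (\<lambda>y. \<Sum>i. complex_of_real (y powr (1 - p)) * h i y) sequentially"
    proof (rule Weierstrass_m_test[OF _ A(1)])
      fix n y assume y: "y \<in> {0<..<2 * x}"
      then have "y powr (1 - p) * norm (h n y) \<le> y powr (1 - p) * (A n * y powr (p - 1))"
        by (intro mult_left_mono A) auto
      also have "\<dots> = A n * (y powr (1 - p) * y powr (p - 1))" by simp
      also have "y powr (1 - p) * y powr (p - 1) = 1" using y by (simp add: powr_add[symmetric])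
      finally show "norm (complex_of_real (y powr (1 - p)) * h n y) \<le> A n"
        by (simp add: norm_mult)
    qed
    then have "continuous_on {0<..<2 * x} (\<lambda>y. \<Sum>i. complex_of_real (y powr (1 - p)) * h i y)"
      by (rule uniform_limit_theorem[rotated])
         (auto intro!: always_eventually continuous_intros continuous_on_subset[OF sing_space_continuous[OF h]])
    then have "continuous_on {0<..<2 * x}
        (\<lambda>y. complex_of_real (y powr (p - 1)) * (\<Sum>i. complex_of_real (y powr (1 - p)) * h i y))"
      by (intro continuous_intros) auto
    moreover have eq: "complex_of_real (y powr (p - 1)) * (\<Sum>i. complex_of_real (y powr (1 - p)) * h i y) = (\<Sum>i. h i y)"
      if "y \<in> {0<..<2 * x}" for y
    proof -
      have "(\<Sum>i. complex_of_real (y powr (1 - p)) * h i y) = complex_of_real (y powr (1 - p)) * (\<Sum>i. h i y)"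
        using that by (intro suminf_mult summable_norm_cancel[OF sing_series_abs_summable]) auto
      moreover have "complex_of_real (y powr (p - 1)) * complex_of_real (y powr (1 - p)) = 1"
        using that unfolding of_real_mult[symmetric] by (simp add: powr_add[symmetric])
      ultimately show ?thesis by (simp add: mult.assoc[symmetric])
    qed
    ultimately have "continuous_on {0<..<2 * x} (\<lambda>y. \<Sum>i. h i y)"
      by (subst (asm) continuous_on_cong[OF refl eq])
    then show ?thesis using x by (simp add: continuous_on_eq_continuous_at)
  qed
  then show "continuous_on {0<..} (\<lambda>x. \<Sum>n. h n x)"
    by (intro continuous_at_imp_continuous_on) auto
qed

text \<open>Sum and integral may be exchanged because the integrals of the norms are at most C A_n
  B(p,q) x^(q+p-1), which is summable in n.\<close>

lemma laplace_conv_sing_series_sums: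
  assumes g: "g \<in> sing_space q" and pq: "p > 0" "q > 0" and x: "x > 0"
  shows "(\<lambda>n. (g \<star> h n) x) sums (g \<star> (\<lambda>x. \<Sum>n. h n x)) x"
proof -
  obtain C where C: "\<And>y. 0 < y \<Longrightarrow> y \<le> x \<Longrightarrow> norm (g y) \<le> C * y powr (q - 1)"
    using sing_spaceE[OF g x] by blast
  obtain A where A1: "summable A" and A2: "\<forall>n. \<forall>y\<in>{0<..x}. norm (h n y) \<le> A n * y powr (p - 1)"
    using bound[of "x"] x by auto
  have A: "summable A" "\<And>n y. 0 < y \<Longrightarrow> y \<le> x \<Longrightarrow> norm (h n y) \<le> A n * y powr (p - 1)"
    using A1 A2 by auto
  have summ: "summable (\<lambda>n. norm (causal (h n) \<xi>))" for \<xi>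
    by (cases "\<xi> > 0") (simp_all add: sing_series_abs_summable)
  have "(\<lambda>n. \<integral>\<xi>. causal g (x - \<xi>) * causal (h n) \<xi> \<partial>lborel) sums
        (\<integral>\<xi>. (\<Sum>n. causal g (x - \<xi>) * causal (h n) \<xi>) \<partial>lborel)"
  proof (rule sums_integral)
    show "integrable lborel (\<lambda>\<xi>. causal g (x - \<xi>) * causal (h n) \<xi>)" for n
      by (rule integrable_conv_integrand[OF g h pq(2,1)])
    show "AE \<xi> in lborel. summable (\<lambda>n. norm (causal g (x - \<xi>) * causal (h n) \<xi>))"
      unfolding norm_mult by (intro AE_I2 summable_mult summ)
    show "summable (\<lambda>n. \<integral>\<xi>. norm (causal g (x - \<xi>) * causal (h n) \<xi>) \<partial>lborel)"
    proof (rule summable_comparison_test'[where N = 0])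
      show "summable (\<lambda>n. C * A n * Beta p q * x powr (q + p - 1))"
        by (intro summable_mult summable_mult2 A)
      show "norm (\<integral>\<xi>. norm (causal g (x - \<xi>) * causal (h n) \<xi>) \<partial>lborel)
              \<le> C * A n * Beta p q * x powr (q + p - 1)" for n
        using integral_norm_conv_integrand_le[OF g h pq(2,1) x C A(2)] by simp
    qed
  qed
  moreover have "(\<Sum>n. causal g (x - \<xi>) * causal (h n) \<xi>) =
      causal g (x - \<xi>) * causal (\<lambda>x. \<Sum>n. h n x) \<xi>" for \<xi>
    using suminf_mult[OF summable_norm_cancel[OF summ], of "causal g (x - \<xi>)" \<xi>]
    by (cases "\<xi> > 0") simp_all
  ultimately show ?thesis by (simp add: laplace_conv_causal)
qed

end

section \<open>Kernels as power-bounded functions, decay of Beta values\<close>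

text \<open>The continuous factor is bounded on the compact interval [0,X].\<close>

lemma C_m1_0_sing_space:
  assumes "g \<in> C_m1_0"
  obtains p where "p > 0" "g \<in> sing_space p"
proof -
  obtain p g1 where p: "0 < p" and cont: "continuous_on {0..} g1"
    and eq: "\<And>x. x > 0 \<Longrightarrow> g x = of_real (x powr (p - 1)) * g1 x"
    using assms unfolding C_m1_0_def by blast
  have "continuous_on {0<..} (\<lambda>x. of_real (x powr (p - 1)) * g1 x)"
    by (intro continuous_intros continuous_on_subset[OF cont]) auto
  then have "continuous_on {0<..} g"
    by (rule continuous_on_cong[THEN iffD1, rotated -1]) (simp_all add: eq)
  moreover have "\<exists>C. \<forall>x\<in>{0<..X}. norm (g x) \<le> C * x powr (p - 1)" for X
  proof -
    have "compact (g1 ` {0..X})"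
      by (intro compact_continuous_image continuous_on_subset[OF cont]) auto
    then obtain C where "\<And>x. x \<in> {0..X} \<Longrightarrow> norm (g1 x) \<le> C"
      by (meson compact_imp_bounded bounded_iff imageI)
    then show ?thesis
      by (intro exI[of _ C]) (auto simp: eq norm_mult mult.commute[of C] intro!: mult_left_mono)
  qed
  ultimately have "g \<in> sing_space p" by (simp add: sing_space_def)
  with p that show ?thesis by blast
qed

text \<open>In Euler's integral the factor t^((n+1)p-1) = t^(p-1) (t^p)^n tends to 0 on (0,1) and is
  dominated by its value at n = 0. The limit drives the ratio test for the convolution
  series.\<close>

lemma Beta_tendsto_0:
  assumes "p > 0"
  shows "(\<lambda>n. Beta ((real n + 1) * p) p) \<longlonglongrightarrow> 0"
proof -
  let ?s = "\<lambda>n t. indicator {0<..<1} t *\<^sub>R ((1 - t) powr (p - 1) * t powr ((real n + 1) * p - 1))"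
  have s: "has_bochner_integral lborel (?s n) (Beta ((real n + 1) * p) p)" for n
    using assms by (intro has_bochner_integral_Beta) auto
  have "(\<lambda>n. integral\<^sup>L lborel (?s n)) \<longlonglongrightarrow> integral\<^sup>L lborel (\<lambda>_::real. 0::real)"
  proof (rule integral_dominated_convergence[where w = "?s 0"])
    show "?s n \<in> borel_measurable lborel" for n
      using s[of n] by (auto simp: has_bochner_integral_iff)
    show "integrable lborel (?s 0)"
      using s[of 0] by (auto simp: has_bochner_integral_iff)
    show "AE t in lborel. (\<lambda>n. ?s n t) \<longlonglongrightarrow> 0"
    proof (rule AE_I2)
      fix t :: real
      show "(\<lambda>n. ?s n t) \<longlonglongrightarrow> 0"
      proof (cases "t \<in> {0<..<1}")
        case True
        have "t powr ((real n + 1) * p - 1) = t powr (p - 1) * (t powr p) ^ n" for n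
          using True by (simp add: powr_realpow[symmetric] powr_powr powr_add[symmetric] algebra_simps)
        moreover have "(\<lambda>n. (1 - t) powr (p - 1) * (t powr (p - 1) * (t powr p) ^ n)) \<longlonglongrightarrow> 0"
          using True assms by (intro tendsto_mult_right_zero LIMSEQ_realpow_zero)
            (use powr_less_mono2[of p t 1] in auto)
        ultimately show ?thesis using True by simp
      qed simp
    qed
    show "AE t in lborel. norm (?s n t) \<le> ?s 0 t" for n
      using assms by (auto simp: indicator_def intro!: mult_left_mono powr_mono')
  qed simp
  moreover have "integral\<^sup>L lborel (?s n) = Beta ((real n + 1) * p) p" for n
    by (rule has_bochner_integral_integral_eq[OF s])
  ultimately show ?thesis by (simp only: integral_zero)
qed

text \<open>Brings all terms of a convolution series into one space: on (0,X] the surplus power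
  x^(q-p) is at most X^(q-p).\<close>

lemma sing_space_mono:
  assumes "g \<in> sing_space q" "p \<le> q"
  shows "g \<in> sing_space p"
  unfolding sing_space_def
proof (safe intro!: sing_space_continuous[OF assms(1)])
  fix X :: real assume "X > 0"
  then obtain C where C: "C \<ge> 0" "\<And>y. 0 < y \<Longrightarrow> y \<le> X \<Longrightarrow> norm (g y) \<le> C * y powr (q - 1)"
    using sing_spaceE[OF assms(1)] by blast
  have "norm (g x) \<le> C * X powr (q - p) * x powr (p - 1)" if "x \<in> {0<..X}" for x
  proof -
    have "norm (g x) \<le> C * (x powr (q - p) * x powr (p - 1))"
      using C(2)[of x] that by (simp add: powr_add[symmetric])
    also have "\<dots> \<le> C * (X powr (q - p) * x powr (p - 1))"
      using that C(1) assms(2) by (intro mult_left_mono mult_right_mono powr_mono2) auto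
    finally show ?thesis by (simp add: mult.assoc)
  qed
  then show "\<exists>C. \<forall>x\<in>{0<..X}. norm (g x) \<le> C * x powr (p - 1)" by blast
qed

lemma sing_space_cmult: "g \<in> sing_space p \<Longrightarrow> (\<lambda>x. c * g x) \<in> sing_space p"
  unfolding sing_space_def
proof (safe intro!: continuous_intros)
  fix X :: real
  assume "X > 0" "\<forall>X>0. \<exists>C. \<forall>x\<in>{0<..X}. norm (g x) \<le> C * x powr (p - 1)"
  then obtain C where "\<forall>x\<in>{0<..X}. norm (g x) \<le> C * x powr (p - 1)" by blast
  then show "\<exists>C. \<forall>x\<in>{0<..X}. norm (c * g x) \<le> C * x powr (p - 1)"
    by (intro exI[of _ "norm c * C"]) (auto simp: norm_mult mult.assoc intro!: mult_left_mono)
qed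

section \<open>Convolution powers and their bounds\<close>

lemma conv_power_1 [simp]: "conv_power g (Suc 0) = g"
  by (simp add: conv_power_def)

lemma conv_power_Suc_Suc [simp]: "conv_power g (Suc (Suc n)) = g \<star> conv_power g (Suc n)"
  by (simp add: conv_power_def)

lemma conv_power_in_sing_space:
  assumes "g \<in> sing_space p" "p > 0"
  shows "conv_power g (Suc n) \<in> sing_space ((real n + 1) * p)"
proof (induction n)
  case (Suc n)
  have "g \<star> conv_power g (Suc n) \<in> sing_space (p + (real n + 1) * p)"
    using assms by (intro sing_space_laplace_conv Suc) auto
  then show ?case by (simp add: algebra_simps)
qed (use assms in simp)

text \<open>The constants obtained by iterating \<open>norm_laplace_conv_le\<close>; in closed form
  they are \<open>(M \<Gamma>(p))\<^sup>n\<^sup>+\<^sup>1 / \<Gamma>((n + 1) p)\<close>, but only the ratio of consecutive ones matters.\<close>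

definition conv_power_coeff :: "real \<Rightarrow> real \<Rightarrow> nat \<Rightarrow> real" where
  "conv_power_coeff M p n = M ^ Suc n * (\<Prod>i<n. Beta ((real i + 1) * p) p)"

lemma conv_power_coeff_Suc:
  "conv_power_coeff M p (Suc n) = M * Beta ((real n + 1) * p) p * conv_power_coeff M p n"
  by (simp add: conv_power_coeff_def)

lemma conv_power_coeff_nonneg: "M \<ge> 0 \<Longrightarrow> p > 0 \<Longrightarrow> conv_power_coeff M p n \<ge> 0"
  unfolding conv_power_coeff_def by (intro mult_nonneg_nonneg prod_nonneg ballI Beta_nonneg) auto

text \<open>Induction on the number of factors with one constant \<open>M\<close> on the whole
  interval. The point \<open>x\<close> is generalized because each step needs the previous bound on
  all of (0,x].\<close>

lemma norm_conv_power_le: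
  assumes g: "g \<in> sing_space p" "p > 0"
    and M: "\<And>y. 0 < y \<Longrightarrow> y \<le> X \<Longrightarrow> norm (g y) \<le> M * y powr (p - 1)"
    and x: "0 < x" "x \<le> X"
  shows "norm (conv_power g (Suc n) x) \<le> conv_power_coeff M p n * x powr ((real n + 1) * p - 1)"
  using x
proof (induction n arbitrary: x)
  case 0
  then show ?case using M by (simp add: conv_power_coeff_def)
next
  case (Suc n)
  have "norm ((g \<star> conv_power g (Suc n)) x) \<le> M * conv_power_coeff M p n * Beta ((real n + 1) * p) p *
          x powr (p + (real n + 1) * p - 1)"
  proof (rule norm_laplace_conv_le[OF g(1) conv_power_in_sing_space[OF g] g(2)])
    show "norm (g y) \<le> M * y powr (p - 1)" if "0 < y" "y \<le> x" for y
      using M that Suc.prems by simp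
    show "norm (conv_power g (Suc n) y) \<le> conv_power_coeff M p n * y powr ((real n + 1) * p - 1)"
      if "0 < y" "y \<le> x" for y
      using Suc.IH[of y] that Suc.prems by simp
  qed (use g Suc.prems in auto)
  then show ?case by (simp add: conv_power_coeff_Suc algebra_simps)
qed

text \<open>For \<open>r\<close> inside the disc of convergence the numbers |a_n| r^n are bounded by
  some \<open>K\<close>. What remains is \<open>?u\<close>, whose successive ratios M (Y/r)
  B((n+1)p, p) tend to 0, however large \<open>Y\<close> is.\<close>

lemma summable_conv_power_coeff:
  fixes a :: "nat \<Rightarrow> complex"
  assumes "conv_radius a > 0" "M \<ge> 0" "p > 0" "Y \<ge> 0"
  shows "summable (\<lambda>n. norm (a n) * conv_power_coeff M p n * Y ^ n)"
proof -
  obtain r where r: "0 < r" "ereal r < conv_radius a"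
    using ereal_dense2[of 0 "conv_radius a"] assms(1) by auto
  let ?u = "\<lambda>n. conv_power_coeff M p n * (Y / r) ^ n"
  have u_nonneg: "?u n \<ge> 0" for n
    using assms r by (simp add: conv_power_coeff_nonneg)
  have "(\<lambda>n. M * (Y / r) * Beta ((real n + 1) * p) p) \<longlonglongrightarrow> M * (Y / r) * 0"
    by (intro tendsto_intros Beta_tendsto_0 assms)
  then have "\<forall>\<^sub>F n in sequentially. M * (Y / r) * Beta ((real n + 1) * p) p < 1 / 2"
    by (rule order_tendstoD) simp
  then obtain N where N: "\<And>n. n \<ge> N \<Longrightarrow> M * (Y / r) * Beta ((real n + 1) * p) p < 1 / 2"
    by (auto simp: eventually_sequentially)
  have summable_u: "summable ?u"
  proof (rule summable_ratio_test[where c = "1 / 2" and N = N])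
    fix n assume "n \<ge> N"
    then have "M * (Y / r) * Beta ((real n + 1) * p) p * ?u n \<le> 1 / 2 * ?u n"
      using u_nonneg[of n] N[of n] by (intro mult_right_mono) auto
    moreover have "?u (Suc n) = M * (Y / r) * Beta ((real n + 1) * p) p * ?u n"
      by (simp add: conv_power_coeff_Suc)
    ultimately show "norm (?u (Suc n)) \<le> 1 / 2 * norm (?u n)"
      using u_nonneg[of n] u_nonneg[of "Suc n"] by (simp only: real_norm_def abs_of_nonneg)
  qed simp
  have "summable (\<lambda>n. a n * of_real r ^ n)"
    using r by (intro summable_in_conv_radius) auto
  then have "Bseq (\<lambda>n. a n * of_real r ^ n)"
    by (intro convergent_imp_Bseq convergentI[OF summable_LIMSEQ_zero])
  then obtain K where K: "\<And>n. norm (a n) * r ^ n \<le> K"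
    using r by (auto simp: Bseq_def norm_mult norm_power)
  show ?thesis
  proof (rule summable_comparison_test'[where N = 0])
    show "summable (\<lambda>n. K * ?u n)" using summable_u by (rule summable_mult)
    fix n
    have "norm (a n) * conv_power_coeff M p n * Y ^ n = (norm (a n) * r ^ n) * ?u n"
      using r by (simp add: power_divide)
    also have "\<dots> \<le> K * ?u n" by (rule mult_right_mono[OF K u_nonneg])
    finally show "norm (norm (a n) * conv_power_coeff M p n * Y ^ n) \<le> K * ?u n"
      using assms by (simp add: conv_power_coeff_nonneg)
  qed
qed

subsection \<open>Convolution series\<close>

text \<open>The coefficient sequence is an argument so that fractional differentiation can be
  expressed as a change of coefficients with the kernel fixed.\<close>

definition conv_series :: "(real \<Rightarrow> complex) \<Rightarrow> (nat \<Rightarrow> complex) \<Rightarrow> real \<Rightarrow> complex" where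
  "conv_series g a x = (\<Sum>n. a n * conv_power g (Suc n) x)"

context
  fixes \<kappa> :: "real \<Rightarrow> complex" and a :: "nat \<Rightarrow> complex" and p :: real
  assumes \<kappa>: "\<kappa> \<in> sing_space p" and p: "p > 0" and a: "conv_radius a > 0"
begin

lemma conv_series_term_in_sing_space: "(\<lambda>x. a n * conv_power \<kappa> (Suc n) x) \<in> sing_space p"
  using p by (intro sing_space_cmult sing_space_mono[OF conv_power_in_sing_space[OF \<kappa> p]])
    (simp add: algebra_simps)

text \<open>Since x^((n+1)p-1) = (x^p)^n x^(p-1), the summability result applies with
  \<open>Y\<close> = X^p. With the preceding lemma this supplies the assumptions for termwise
  convolution.\<close>

lemma conv_series_term_bound:
  assumes "X > 0"
  shows "\<exists>A. summable A \<and> (\<forall>n. \<forall>x\<in>{0<..X}. norm (a n * conv_power \<kappa> (Suc n) x) \<le> A n * x powr (p - 1))"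
proof -
  obtain M where M: "M \<ge> 0" "\<And>y. 0 < y \<Longrightarrow> y \<le> X \<Longrightarrow> norm (\<kappa> y) \<le> M * y powr (p - 1)"
    using sing_spaceE[OF \<kappa> assms] by blast
  let ?A = "\<lambda>n. norm (a n) * conv_power_coeff M p n * (X powr p) ^ n"
  have "norm (a n * conv_power \<kappa> (Suc n) x) \<le> ?A n * x powr (p - 1)" if x: "x \<in> {0<..X}" for n x
  proof -
    have "(real n + 1) * p - 1 = real n * p + (p - 1)" by (simp add: algebra_simps)
    then have "x powr ((real n + 1) * p - 1) = (x powr p) ^ n * x powr (p - 1)"
      using x by (simp only: powr_add) (simp add: powr_powr powr_realpow[symmetric] mult.commute)
    also have "\<dots> \<le> (X powr p) ^ n * x powr (p - 1)"
      using x p by (intro mult_right_mono power_mono powr_mono2) auto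
    finally have le: "x powr ((real n + 1) * p - 1) \<le> (X powr p) ^ n * x powr (p - 1)" .
    have "norm (conv_power \<kappa> (Suc n) x) \<le> conv_power_coeff M p n * x powr ((real n + 1) * p - 1)"
      using x by (intro norm_conv_power_le[OF \<kappa> p M(2)]) auto
    also have "\<dots> \<le> conv_power_coeff M p n * ((X powr p) ^ n * x powr (p - 1))"
      by (intro mult_left_mono le conv_power_coeff_nonneg M p)
    finally show ?thesis
      by (simp only: norm_mult mult.assoc) (intro mult_left_mono; simp)
  qed
  moreover have "summable ?A"
    by (intro summable_conv_power_coeff a M p) auto
  ultimately show ?thesis by blast
qed

lemma conv_series_summable:
  "x > 0 \<Longrightarrow> summable (\<lambda>n. a n * conv_power \<kappa> (Suc n) x)"
  by (rule summable_norm_cancel[OF sing_series_abs_summable[OF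
        conv_series_term_in_sing_space conv_series_term_bound]])

lemma conv_series_in_sing_space: "conv_series \<kappa> a \<in> sing_space p"
  unfolding conv_series_def[abs_def]
  by (rule sing_series_in_sing_space[OF conv_series_term_in_sing_space conv_series_term_bound])

lemma laplace_conv_conv_series_sums:
  assumes "x > 0"
  shows "(\<lambda>n. a n * conv_power \<kappa> (Suc (Suc n)) x) sums (\<kappa> \<star> conv_series \<kappa> a) x"
  using laplace_conv_sing_series_sums[OF conv_series_term_in_sing_space conv_series_term_bound \<kappa> p p assms]
  by (simp add: laplace_conv_cmult_right conv_series_def[abs_def])

end

section \<open>The Sonine kernel acting on a convolution series\<close>

lemma conv_series_shift:
  assumes "\<kappa> \<in> sing_space p" "p > 0" "conv_radius a > 0" "x > 0"
  shows "conv_series \<kappa> a x = a 0 * \<kappa> x + (\<kappa> \<star> conv_series \<kappa> (\<lambda>n. a (Suc n))) x"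
proof -
  have "conv_radius (\<lambda>n. a (Suc n)) > 0"
    using conv_radius_shift[of a 1] assms(3) by simp
  then have "(\<lambda>n. a (Suc n) * conv_power \<kappa> (Suc (Suc n)) x) sums
      (\<kappa> \<star> conv_series \<kappa> (\<lambda>n. a (Suc n))) x"
    by (rule laplace_conv_conv_series_sums[OF assms(1,2) _ assms(4)])
  then show ?thesis
    unfolding conv_series_def
    using suminf_split_head[OF conv_series_summable[OF assms]]
    by (simp add: sums_iff)
qed

text \<open>The right-hand side displays both data needed later: its limit at 0 is the leading
  coefficient and its derivative is the series with shifted coefficients.\<close>

lemma sonine_conv_series:
  assumes \<kappa>: "\<kappa> \<in> sing_space p" and k: "k \<in> sing_space q" and pq: "p > 0" "q > 0"
    and one: "\<And>x. x > 0 \<Longrightarrow> (\<kappa> \<star> k) x = 1"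
    and a: "conv_radius a > 0" and x: "x > 0"
  shows "(k \<star> conv_series \<kappa> a) x = a 0 + ((\<lambda>_. 1) \<star> conv_series \<kappa> (\<lambda>n. a (Suc n))) x"
proof -
  let ?T = "conv_series \<kappa> (\<lambda>n. a (Suc n))"
  have a': "conv_radius (\<lambda>n. a (Suc n)) > 0"
    using conv_radius_shift[of a 1] a by simp
  have T: "?T \<in> sing_space p" by (rule conv_series_in_sing_space[OF \<kappa> pq(1) a'])
  have one': "(k \<star> \<kappa>) y = 1" if "y > 0" for y
    using one[OF that] by (simp add: laplace_conv_commute[of k])
  have "k \<star> conv_series \<kappa> a = k \<star> (\<lambda>x. a 0 * \<kappa> x + (\<kappa> \<star> ?T) x)"
    by (rule laplace_conv_cong) (auto simp: conv_series_shift[OF \<kappa> pq(1) a])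
  moreover have "(k \<star> (\<lambda>x. a 0 * \<kappa> x + (\<kappa> \<star> ?T) x)) x =
      (k \<star> (\<lambda>x. a 0 * \<kappa> x)) x + (k \<star> (\<kappa> \<star> ?T)) x"
    using pq by (intro laplace_conv_add_right x conv_integrable_sing_space[OF k sing_space_cmult[OF \<kappa>]]
        conv_integrable_sing_space[OF k sing_space_laplace_conv[OF \<kappa> T]]) auto
  moreover have "(k \<star> (\<lambda>x. a 0 * \<kappa> x)) x = a 0"
    by (simp add: laplace_conv_cmult_right one' x)
  moreover have "k \<star> (\<kappa> \<star> ?T) = (\<lambda>_. 1) \<star> ?T"
    unfolding laplace_conv_assoc[OF k \<kappa> T pq(2,1,1)]
    \<comment> \<open>\<open>k \<star> \<kappa>\<close> is 1 at positive arguments but 0 elsewhere,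
      so it is replaced by congruence and not by an equality of functions.\<close>
    by (rule laplace_conv_cong) (auto simp: one')
  ultimately show ?thesis by simp
qed

text \<open>Infinite sum, integral and derivative are total operators, so convergence, integrability
  and differentiability are part of the conclusion; otherwise the limit could concern default
  values. The value at 0 is the right-hand limit.\<close>

theorem theorem3p2:
  fixes \<kappa> k f :: "real \<Rightarrow> complex" and a :: "nat \<Rightarrow> complex"
  assumes "sonine_pair \<kappa> k"
    and "conv_radius a > 0"
    and "\<And>x. x > 0 \<Longrightarrow> f x = (\<Sum>j. a j * conv_power \<kappa> (j + 1) x)"
  shows "(\<forall>x>0. summable (\<lambda>j. a j * conv_power \<kappa> (j + 1) x)) \<and>
         (\<forall>j. (\<forall>i<j. GFD_exists k (GFD_seq k i f)) \<and>
              conv_integrable k (GFD_seq k j f) \<and>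
              (GFI k (GFD_seq k j f) \<longlongrightarrow> a j) (at_right 0))"
proof -
  obtain p where p: "p > 0" and \<kappa>: "\<kappa> \<in> sing_space p"
    using C_m1_0_sing_space assms(1) unfolding sonine_pair_def by blast
  obtain q where q: "q > 0" and k: "k \<in> sing_space q"
    using C_m1_0_sing_space assms(1) unfolding sonine_pair_def by blast
  have one: "\<And>x. x > 0 \<Longrightarrow> (\<kappa> \<star> k) x = 1"
    using assms(1) by (simp add: sonine_pair_def)
  \<comment> \<open>The coefficients shifted \<open>j\<close> times; \<open>?S j\<close> will turn
    out to be the \<open>j\<close>-th sequential derivative on the positive axis.\<close>
  let ?b = "\<lambda>j n. a (n + j)"
  let ?S = "\<lambda>j. conv_series \<kappa> (?b j)"
  have b: "conv_radius (?b j) > 0" for j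
    using assms(2) by (simp add: conv_radius_shift)
  have S: "?S j \<in> sing_space p" for j
    by (rule conv_series_in_sing_space[OF \<kappa> p b])
  have kS: "(k \<star> ?S j) x = a j + ((\<lambda>_. 1) \<star> ?S (Suc j)) x" if "x > 0" for j x
    using sonine_conv_series[OF \<kappa> k p q one b that, of j] by simp
  have deriv: "((k \<star> ?S j) has_vector_derivative ?S (Suc j) x) (at x)" if x: "x > 0" for j x
  proof -
    have "((\<lambda>x. a j + ((\<lambda>_. 1) \<star> ?S (Suc j)) x) has_vector_derivative 0 + ?S (Suc j) x) (at x)"
      by (intro derivative_intros has_vector_derivative_one_conv[OF S p x])
    then have "((\<lambda>x. a j + ((\<lambda>_. 1) \<star> ?S (Suc j)) x) has_vector_derivative ?S (Suc j) x) (at x)"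
      by simp
    then show ?thesis
      by (rule has_vector_derivative_transform_within_open[of _ _ _ "{0<..}"]) (use x kS in auto)
  qed
  have seq: "GFD_seq k j f x = ?S j x" if "x > 0" for j x
    using that
  proof (induction j arbitrary: x)
    case 0
    then show ?case using assms(3) by (simp add: GFD_seq_def conv_series_def)
  next
    case (Suc j)
    \<comment> \<open>Agreement at positive arguments gives equal convolutions as total functions,
      so the derivative of the one is that of the other.\<close>
    have "k \<star> GFD_seq k j f = k \<star> ?S j"
      by (rule laplace_conv_cong) (auto simp: Suc.IH)
    then show ?case
      using vector_derivative_at[OF deriv[OF Suc.prems]] by (simp add: GFD_seq_def GFD_def)
  qed
  have conv_eq: "k \<star> GFD_seq k j f = k \<star> ?S j" for j
    by (rule laplace_conv_cong) (auto simp: seq)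
  have int: "conv_integrable k (GFD_seq k j f)" for j
    using conv_integrable_sing_space[OF k S q p] conv_integrable_cong[of k k "GFD_seq k j f" "?S j"] seq
    by simp
  have "GFD_exists k (GFD_seq k j f)" for j
    using int deriv[of _ j] by (auto simp: GFD_exists_def conv_eq intro: differentiableI_vector)
  moreover have "(GFI k (GFD_seq k j f) \<longlongrightarrow> a j) (at_right 0)" for j
  proof -
    have "((\<lambda>x. a j + ((\<lambda>_. 1) \<star> ?S (Suc j)) x) \<longlongrightarrow> a j + 0) (at_right 0)"
      by (intro tendsto_intros tendsto_0_one_conv[OF S p])
    \<comment> \<open>The two functions agree to the right of 0, and \<open>back_subst\<close>
      rewrites the limit \<open>a j + 0\<close> to \<open>a j\<close>.\<close>
    then show ?thesis
      by (rule Lim_transform_eventually[where f = "\<lambda>x. a j + ((\<lambda>_. 1) \<star> ?S (Suc j)) x", THEN back_subst[of "\<lambda>l. (_ \<longlongrightarrow> l) _"]])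
         (auto simp: GFI_def conv_eq kS eventually_at_right_field intro!: exI[of _ 1])
  qed
  moreover have "summable (\<lambda>j. a j * conv_power \<kappa> (j + 1) x)" if "x > 0" for x
    using conv_series_summable[OF \<kappa> p assms(2) that] by simp
  ultimately show ?thesis using int by blast
qed

end
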